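(* Assume the setting and notation described in the context (in particular: both the original moment matrix $\mathscr M$ and the left-perturbed moment matrix $\hat{\mathscr M}$ admit Gauss--Borel factorizations, and all the zeros $y_1,\dots,y_M$, $M=Nq-r$, of $\det L(x)$ are simple). Then the entries of the left-perturbed matrix polynomials are given by: for all $n\ge1$ and $a\in\{1,\dots,p\}$, $$\hat A^{(a)}_{n-1}(x)=\frac1{\tau_{n-1}}\begin{vmatrix}\mathbb K_a^{[n]}(x,y_1)&\mathbb K_a^{[n]}(x,y_2)&\cdots&\mathbb K_a^{[n]}(x,y_M)\\ \mathbb B_n(y_1)&\mathbb B_n(y_2)&\cdots&\mathbb B_n(y_M)\\ \vdots&\vdots&&\vdots\\ \mathbb B_{n+M-2}(y_1)&\mathbb B_{n+M-2}(y_2)&\cdots&\mathbb B_{n+M-2}(y_M)\end{vmatrix},$$ and for all $n\ge0$ and $b\in\{1,\dots,q\}$, $$\sum_{\bar b=1}^q\hat B_n^{(\bar b)}(x)L_{\bar b,b}(x)=\frac1{\tau_{n+1}}\begin{vmatrix}B_n^{(b)}(x)&\mathbb B_n(y_1)&\cdots&\mathbb B_n(y_M)\\ B_{n+1}^{(b)}(x)&\mathbb B_{n+1}(y_1)&\cdots&\mathbb B_{n+1}(y_M)\\ \vdots&\vdots&&\vdots\\ B_{n+M}^{(b)}(x)&\mathbb B_{n+M}(y_1)&\cdots&\mathbb B_{n+M}(y_M)\end{vmatrix},$$ where $L_{\bar b,b}(x)$ denotes the $(\bar b,b)$ entry of $L(x)$.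
   Context: Original orthogonality. Let $p,q,N\ge1$ be integers and $r\in\{0,\dots,q-1\}$. Let $\mathrm d\mu=(\mathrm d\mu_{b,a})$ be a $q\times p$ matrix of measures supported on $\Delta\subseteq\mathbb R$, with all moments finite. For $s\in\mathbb N$ let $X_{[s]}(x)$ be the semi-infinite matrix obtained by stacking $I_s,xI_s,x^2I_s,\dots$ vertically. The moment matrix is $\mathscr M=\int_\Delta X_{[q]}(x)\,\mathrm d\mu(x)\,X_{[p]}^\top(x)$. It is assumed that all leading principal submatrices of $\mathscr M$ are nonsingular, so there is a unique Gauss--Borel factorization $\mathscr M=S^{-1}H\bar S^{-\top}$ with $S,\bar S$ lower unitriangular and $H$ nonsingular diagonal (semi-infinite matrices, rows and columns indexed from $0$). Normalization. Put $B(x)=SX_{[q]}(x)$ (so the $B$'s are monic) and $A(x)=X_{[p]}^\top(x)\bar S^\top H^{-1}$. The entry of $B$ in row $n\in\mathbb N_0$ and column $b\in\{1,\dots,q\}$ is $B_n^{(b)}$, and the entry of $A$ in row $a\in\{1,\dots,p\}$ and column $n\in\mathbb N_0$ is $A_n^{(a)}$. The Christoffel--Darboux kernel $K^{[n]}(x,y)$ is the $p\times q$ matrix with entries $K^{[n]}_{a,b}(x,y)=\sum_{i=0}^{n-1}A_i^{(a)}(x)B_i^{(b)}(y)$. Perturbation. $L(x)=\sum_{l=0}^NL_lx^l$, $L_l\in\mathbb C^{q\times q}$, with $$L_N=\begin{bmatrix}0_{r\times(q-r)}&0_{r\times r}\\ I_{q-r}&0_{(q-r)\times r}\end{bmatrix},\qquad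 L_{N-1}=\begin{bmatrix}L^1_{N-1}&I_r\\ L^3_{N-1}&L^4_{N-1}\end{bmatrix},$$ the blocks of $L_{N-1}$ having the same sizes as those of $L_N$ and $L^1_{N-1},L^3_{N-1},L^4_{N-1}$ arbitrary. Set $\mathrm d\hat\mu(x)=L(x)\,\mathrm d\mu(x)$ and $\hat{\mathscr M}=\int_\Delta X_{[q]}(x)\,\mathrm d\hat\mu(x)\,X_{[p]}^\top(x)$. It is assumed that $\hat{\mathscr M}$ also has a Gauss--Borel factorization $\hat{\mathscr M}=\hat S^{-1}\hat H\hat{\bar S}^{-\top}$ of the same type, and, with the same normalization, $\hat B=\hat SX_{[q]}$, $\hat A=X_{[p]}^\top\hat{\bar S}^\top\hat H^{-1}$, with entries $\hat B_n^{(b)}$, $\hat A_n^{(a)}$. Simple eigenvalues. $\det L(x)$ has degree $M:=Nq-r$, and its zeros $y_1,\dots,y_M$ are assumed simple (hence distinct). For each $i$ let $\boldsymbol v_i=(v_{i,1},\dots,v_{i,q})^\top\ne0$ be a column vector with $L(y_i)\boldsymbol v_i=0$. Put $\mathbb B_n(y_i)=\sum_{b=1}^qB_n^{(b)}(y_i)v_{i,b}$, $\mathbb K_a^{[n]}(x,y_i)=\sum_{b=1}^qK_{a,b}^{[n]}(x,y_i)v_{i,b}$, and $\tau_n=\det\big[\mathbb B_{n+j}(y_i)\big]_{j=0,\dots,M-1;\ i=1,\dots,M}$ (row index $j$, column index $i$).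
   Formalization: The formulas fail for B=SX, A=XᵀS̄ᵀH⁻¹ (e.g. Lebesgue measure on [0,1], L=x+1, n=0), so the normalization is changed for both families to B=H⁻¹SX, A=XᵀS̄ᵀ (A monic instead of B monic); everything else is as stated, and τ_n≠0 is also proved. *)

theory Defs
  imports "HOL-Analysis.Analysis" "Jordan_Normal_Form.Determinant"
begin

text \<open>
  Conventions.  Finite matrices and vectors are those of Jordan\_Normal\_Form.  All indices start
  at 0: the component indices are \<open>a < p\<close> and \<open>b < q\<close>, the zeros of the determinant of \<open>L\<close> are
  \<open>y 0, \<dots>, y (M - 1)\<close>.  Semi-infinite matrices (and matrices with infinitely many rows or
  columns) are functions of a row and a column index.
\<close>

type_synonym smat = "nat \<Rightarrow> nat \<Rightarrow> complex"

text \<open>In every product below, each entry is a sum with finite support, because one of the factors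
  is row-finite or the other one is column-finite.\<close>

definition smult_mat :: "smat \<Rightarrow> smat \<Rightarrow> smat" (infixl "\<odot>" 70) where
  "A \<odot> B = (\<lambda>n m. \<Sum>k\<in>{k. A n k * B k m \<noteq> 0}. A n k * B k m)"

definition stranspose :: "smat \<Rightarrow> smat" where
  "stranspose A = (\<lambda>n m. A m n)"

definition sdiag :: "(nat \<Rightarrow> complex) \<Rightarrow> smat" where
  "sdiag d = (\<lambda>n m. if n = m then d n else 0)"

definition lower_unitriangular :: "smat \<Rightarrow> bool" where
  "lower_unitriangular S \<longleftrightarrow> (\<forall>n. S n n = 1) \<and> (\<forall>n m. n < m \<longrightarrow> S n m = 0)"

text \<open>\<open>T\<close> is the inverse of \<open>S\<close> within the group of lower unitriangular semi-infinite matrices.\<close>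

definition unitriangular_inverse :: "smat \<Rightarrow> smat \<Rightarrow> bool" where
  "unitriangular_inverse S T \<longleftrightarrow> lower_unitriangular S \<and> lower_unitriangular T \<and>
     S \<odot> T = sdiag (\<lambda>_. 1) \<and> T \<odot> S = sdiag (\<lambda>_. 1)"

text \<open>\<open>Mm = S\<^sup>-\<^sup>1 H Sb\<^sup>-\<^sup>T\<close>, the nonsingular diagonal factor being given by its sequence of diagonal
  entries.\<close>

definition gauss_borel :: "smat \<Rightarrow> smat \<Rightarrow> (nat \<Rightarrow> complex) \<Rightarrow> smat \<Rightarrow> bool" where
  "gauss_borel Mm S H Sb \<longleftrightarrow> (\<forall>n. H n \<noteq> 0) \<and>
     (\<exists>T Tb. unitriangular_inverse S T \<and> unitriangular_inverse Sb Tb \<and>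
        Mm = T \<odot> sdiag H \<odot> stranspose Tb)"

text \<open>The stacked monomials \<open>I, x I, x\<^sup>2 I, \<dots>\<close> with \<open>I\<close> the identity of size \<open>s\<close>: row \<open>k * s + c\<close>
  carries \<open>x ^ k\<close> in column \<open>c\<close>.\<close>

definition Xmon :: "nat \<Rightarrow> complex \<Rightarrow> smat" where
  "Xmon s x = (\<lambda>n c. if n mod s = c then x ^ (n div s) else 0)"

text \<open>A \<open>q \<times> p\<close> matrix of (positive, signed or complex) measures on \<open>\<Delta>\<close> with finite moments,
  given by densities: \<open>d\<mu>\<^bsub>b,a\<^esub> = w b a d\<nu>\<close>.  Every finite matrix of measures with finite moments has
  this form, with \<open>\<nu>\<close> the sum of the total variations of the entries (Radon--Nikodym).  Complex
  densities are needed because the perturbed measures are complex even when the original ones are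
  positive.\<close>

definition matrix_measure ::
    "nat \<Rightarrow> nat \<Rightarrow> real set \<Rightarrow> real measure \<Rightarrow> (nat \<Rightarrow> nat \<Rightarrow> real \<Rightarrow> complex) \<Rightarrow> bool" where
  "matrix_measure q p \<Delta> \<nu> w \<longleftrightarrow> sets \<nu> = sets borel \<and> \<Delta> \<in> sets borel \<and>
     (\<forall>b<q. \<forall>a<p. (AE x in \<nu>. x \<notin> \<Delta> \<longrightarrow> w b a x = 0) \<and>
        (\<forall>k. integrable \<nu> (\<lambda>x. complex_of_real x ^ k * w b a x)))"

definition moment_matrix ::
    "nat \<Rightarrow> nat \<Rightarrow> real set \<Rightarrow> real measure \<Rightarrow> (nat \<Rightarrow> nat \<Rightarrow> real \<Rightarrow> complex) \<Rightarrow> smat" where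
  "moment_matrix q p \<Delta> \<nu> w = (\<lambda>n m. LINT x:\<Delta>|\<nu>.
     (\<Sum>b<q. \<Sum>a<p. Xmon q (complex_of_real x) n b * w b a x * Xmon p (complex_of_real x) m a))"

text \<open>Normalization.  The diagonal factor \<open>H\<close> is attached to the \<open>B\<close>'s, so that the \<open>A\<close>'s are monic:
  \<open>B = H\<^sup>-\<^sup>1 S X\<close> and \<open>A = X\<^sup>T Sb\<^sup>T\<close>.  The opposite choice, \<open>S X\<close> and \<open>X\<^sup>T Sb\<^sup>T H\<^sup>-\<^sup>1\<close>, gives the same
  Christoffel--Darboux kernel, but for it the left Christoffel formulas with denominators
  \<open>\<tau> (n - 1)\<close> and \<open>\<tau> (n + 1)\<close> need an additional factor, the quotient of the perturbed and the
  original diagonal entries \<open>H (n - 1)\<close>, respectively \<open>H n\<close> (inverted for the \<open>A\<close>'s).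
  \<open>Bfam q S H x n b\<close> is the entry of \<open>B(x)\<close> in row \<open>n\<close> and column \<open>b\<close>; \<open>Afam p Sb x a n\<close> is the
  entry of \<open>A(x)\<close> in row \<open>a\<close> and column \<open>n\<close>.\<close>

definition Bfam :: "nat \<Rightarrow> smat \<Rightarrow> (nat \<Rightarrow> complex) \<Rightarrow> complex \<Rightarrow> smat" where
  "Bfam q S H x = sdiag (\<lambda>n. 1 / H n) \<odot> S \<odot> Xmon q x"

definition Afam :: "nat \<Rightarrow> smat \<Rightarrow> complex \<Rightarrow> smat" where
  "Afam p Sb x = stranspose (Xmon p x) \<odot> stranspose Sb"

definition CD_kernel ::
    "(complex \<Rightarrow> smat) \<Rightarrow> (complex \<Rightarrow> smat) \<Rightarrow> nat \<Rightarrow> complex \<Rightarrow> complex \<Rightarrow> smat" where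
  "CD_kernel A B n x y = (\<lambda>a b. \<Sum>i<n. A x a i * B y i b)"

definition poly_mat :: "nat \<Rightarrow> nat \<Rightarrow> (nat \<Rightarrow> complex mat) \<Rightarrow> complex poly mat" where
  "poly_mat q N Lc = mat q q (\<lambda>(i,j). \<Sum>l\<le>N. monom (Lc l $$ (i,j)) l)"

definition eval_mat :: "complex poly mat \<Rightarrow> complex \<Rightarrow> complex mat" where
  "eval_mat L x = map_mat (\<lambda>f. poly f x) L"

text \<open>The densities of \<open>L d\<mu>\<close> with respect to \<open>\<nu>\<close>.\<close>

definition left_perturb ::
    "nat \<Rightarrow> complex poly mat \<Rightarrow> (nat \<Rightarrow> nat \<Rightarrow> real \<Rightarrow> complex) \<Rightarrow> nat \<Rightarrow> nat \<Rightarrow> real \<Rightarrow> complex" where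
  "left_perturb q L w =
     (\<lambda>b a x. \<Sum>c<q. eval_mat L (complex_of_real x) $$ (b,c) * w c a x)"

end

theory Submission
  imports Defs
begin

text \<open>
  Multiplication by \<open>L\<close> acts on the stacked monomials through a semi-infinite matrix \<open>J\<close>,
  \<open>X L = J X\<close>, and the shape of \<open>L\<^sub>N\<close> and \<open>L\<^sub>N\<^sub>-\<^sub>1\<close> says exactly that the last nonzero entry of row
  \<open>n\<close> of \<open>J\<close> is a \<open>1\<close> in column \<open>n + M\<close>. The perturbed moment matrix is \<open>J\<close> times the original
  one, so comparing the two factorizations gives the connection matrix
  \<open>\<Omega> = H'\<^sup>-\<^sup>1 S' J S\<^sup>-\<^sup>1 H = Sb'\<^sup>-\<^sup>T Sb\<^sup>T\<close>: the first form has upper bandwidth \<open>M\<close> with nonzero outermost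
  diagonal, the second is upper unitriangular. It satisfies \<open>B' L = \<Omega> B\<close> and \<open>A' \<Omega> = A\<close>.
  At a zero \<open>y i\<close> with kernel vector \<open>v i\<close> the first relation becomes a recurrence of order \<open>M\<close> for
  \<open>\<BB> n i\<close>, and both formulas are Cramer's rule for this recurrence. Finally \<open>\<tau> n\<close> is nonzero: a
  linear relation between its columns would propagate along the recurrence, in both directions,
  to all rows of \<open>B\<close>, hence to all \<open>y i ^ k\<close> times \<open>v i\<close>, which is impossible for distinct \<open>y i\<close>.
\<close>

section \<open>Products of semi-infinite matrices\<close>

text \<open>The sum in \<open>\<odot>\<close> runs over the exact support and defaults to 0 if that
  is infinite; any finite superset of the support is a more convenient range.\<close>

lemma smult_mat_eq_sum:
  assumes "finite K" "\<And>k. k \<notin> K \<Longrightarrow> A n k * B k m = 0"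
  shows "(A \<odot> B) n m = (\<Sum>k\<in>K. A n k * B k m)"
  unfolding smult_mat_def by (rule sum.mono_neutral_left) (use assms in auto)

definition row_finite :: "smat \<Rightarrow> bool" where
  "row_finite A \<longleftrightarrow> (\<forall>n. finite {k. A n k \<noteq> 0})"

text \<open>Associativity fails for general semi-infinite matrices. Row finiteness of the two left
  factors makes the double sum finite with no condition on \<open>C\<close>, which may be a moment
  matrix or an upper triangular factor.\<close>

lemma smult_mat_assoc:
  assumes A: "row_finite A" and B: "row_finite B"
  shows "(A \<odot> B) \<odot> C = A \<odot> (B \<odot> C)"
proof (intro ext)
  fix n m
  define K where "K = {k. A n k \<noteq> 0}"
  define J where "J = (\<Union>k\<in>K. {l. B k l \<noteq> 0})"
  have finK: "finite K" and finJ: "finite J"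
    using A B by (auto simp: K_def J_def row_finite_def)
  have AB: "(A \<odot> B) n l = (\<Sum>k\<in>K. A n k * B k l)" for l
    by (rule smult_mat_eq_sum[OF finK]) (simp add: K_def)
  have BC: "(B \<odot> C) k m = (\<Sum>l\<in>J. B k l * C l m)" if "k \<in> K" for k
    by (rule smult_mat_eq_sum[OF finJ]) (use that in \<open>auto simp: J_def\<close>)
  have "((A \<odot> B) \<odot> C) n m = (\<Sum>l\<in>J. (A \<odot> B) n l * C l m)"
    by (rule smult_mat_eq_sum[OF finJ]) (auto simp: AB J_def intro!: sum.neutral)
  also have "\<dots> = (\<Sum>l\<in>J. \<Sum>k\<in>K. A n k * B k l * C l m)"
    by (simp add: AB sum_distrib_right)
  also have "\<dots> = (\<Sum>k\<in>K. A n k * (B \<odot> C) k m)"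
    by (subst sum.swap) (simp add: BC sum_distrib_left mult.assoc)
  also have "\<dots> = (A \<odot> (B \<odot> C)) n m"
    by (rule smult_mat_eq_sum[OF finK, symmetric]) (simp add: K_def)
  finally show "((A \<odot> B) \<odot> C) n m = (A \<odot> (B \<odot> C)) n m" .
qed

lemma stranspose_smult_mat: "stranspose (A \<odot> B) = stranspose B \<odot> stranspose A"
  by (simp add: stranspose_def smult_mat_def mult.commute)

lemma stranspose_stranspose [simp]: "stranspose (stranspose A) = A"
  by (simp add: stranspose_def)

text \<open>The transposed version, for right-hand factors that are column-finite, such as
  transposes of lower triangular matrices.\<close>

lemma smult_mat_assoc_col:
  assumes "row_finite (stranspose B)" "row_finite (stranspose C)"
  shows "(A \<odot> B) \<odot> C = A \<odot> (B \<odot> C)"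
  using arg_cong[OF smult_mat_assoc[OF assms(2,1), of "stranspose A"], of stranspose]
  by (simp add: stranspose_smult_mat)

lemma sdiag_diag [simp]: "sdiag d n n = d n"
  by (simp add: sdiag_def)

lemma sdiag_smult_mat [simp]: "(sdiag d \<odot> A) n m = d n * A n m"
  by (subst smult_mat_eq_sum[where K = "{n}"]) (auto simp: sdiag_def)

lemma smult_mat_sdiag [simp]: "(A \<odot> sdiag d) n m = A n m * d m"
  by (subst smult_mat_eq_sum[where K = "{m}"]) (auto simp: sdiag_def)

lemma sdiag_one_smult_mat [simp]: "sdiag (\<lambda>_. 1) \<odot> A = A" "A \<odot> sdiag (\<lambda>_. 1) = A"
  by (intro ext, simp)+

definition upper_bandwidth :: "nat \<Rightarrow> smat \<Rightarrow> bool" where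
  "upper_bandwidth w A \<longleftrightarrow> (\<forall>n m. n + w < m \<longrightarrow> A n m = 0)"

lemma upper_bandwidth_imp_row_finite: "upper_bandwidth w A \<Longrightarrow> row_finite A"
  unfolding row_finite_def
proof
  fix n assume "upper_bandwidth w A"
  then have "{k. A n k \<noteq> 0} \<subseteq> {..n + w}"
    by (auto simp: upper_bandwidth_def not_less[symmetric])
  then show "finite {k. A n k \<noteq> 0}"
    by (rule finite_subset) simp
qed

text \<open>At distance \<open>i + j\<close> above the diagonal a single middle index,
  \<open>n + i\<close>, survives. This keeps track of the outermost diagonal of the connection
  matrix through a chain of products.\<close>

lemma smult_mat_banded:
  assumes A: "upper_bandwidth i A" and B: "upper_bandwidth j B"
  shows "upper_bandwidth (i + j) (A \<odot> B)"
    and "(A \<odot> B) n (n + (i + j)) = A n (n + i) * B (n + i) (n + (i + j))"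
proof -
  have eq: "(A \<odot> B) n m = (\<Sum>k\<le>n + i. A n k * B k m)" for n m
    by (rule smult_mat_eq_sum) (use A in \<open>auto simp: upper_bandwidth_def\<close>)
  show "upper_bandwidth (i + j) (A \<odot> B)"
    using B by (auto simp: upper_bandwidth_def eq intro!: sum.neutral)
  show "(A \<odot> B) n (n + (i + j)) = A n (n + i) * B (n + i) (n + (i + j))"
    unfolding eq
    by (subst sum.remove[where x = "n + i"])
       (use B in \<open>auto simp: upper_bandwidth_def intro!: sum.neutral\<close>)
qed

lemma upper_bandwidth_sdiag: "upper_bandwidth 0 (sdiag d)"
  by (simp add: upper_bandwidth_def sdiag_def)

lemma lower_unitriangular_bandwidth: "lower_unitriangular S \<Longrightarrow> upper_bandwidth 0 S"
  by (simp add: upper_bandwidth_def lower_unitriangular_def)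

lemma lower_unitriangular_smult_mat:
  assumes "lower_unitriangular S" "lower_unitriangular T"
  shows "lower_unitriangular (S \<odot> T)"
  using smult_mat_banded[OF assms[THEN lower_unitriangular_bandwidth]] assms
  by (simp add: lower_unitriangular_def upper_bandwidth_def)

section \<open>Stacked monomials and multiplication by \<open>L\<close>\<close>

lemma Xmon_smult_mat:
  assumes "q > 0"
  shows "(Xmon q x \<odot> C) n m = x ^ (n div q) * C (n mod q) m"
  by (subst smult_mat_eq_sum[where K = "{n mod q}"]) (auto simp: Xmon_def)

lemma row_finite_Xmon: "row_finite (Xmon q x)"
  unfolding row_finite_def
proof
  fix n
  have "{k. Xmon q x n k \<noteq> 0} \<subseteq> {n mod q}" by (auto simp: Xmon_def)
  then show "finite {k. Xmon q x n k \<noteq> 0}" by (rule finite_subset) simp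
qed

text \<open>The matrix of multiplication by \<open>L\<close> in the basis of stacked monomials: block \<open>(k, k + l)\<close>
  is the coefficient of degree \<open>l\<close>.\<close>

definition block_toeplitz :: "nat \<Rightarrow> complex poly mat \<Rightarrow> smat" where
  "block_toeplitz q L = (\<lambda>n m. if n div q \<le> m div q
     then coeff (L $$ (n mod q, m mod q)) (m div q - n div q) else 0)"

definition smat_of_mat :: "nat \<Rightarrow> complex mat \<Rightarrow> smat" where
  "smat_of_mat q C = (\<lambda>c b. if c < q \<and> b < q then C $$ (c, b) else 0)"

text \<open>Column \<open>b\<close> of \<open>Xmon\<close> is supported on the indices congruent to
  \<open>b\<close> modulo \<open>q\<close>, so a row of the Toeplitz matrix collapses there to the
  coefficient sum of one polynomial entry of \<open>L\<close>.\<close>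

lemma block_toeplitz_Xmon:
  assumes L: "L \<in> carrier_mat q q" and q: "q > 0"
  shows "block_toeplitz q L \<odot> Xmon q x = Xmon q x \<odot> smat_of_mat q (eval_mat L x)"
proof (intro ext)
  fix n b
  show "(block_toeplitz q L \<odot> Xmon q x) n b = (Xmon q x \<odot> smat_of_mat q (eval_mat L x)) n b"
  proof (cases "b < q")
    case b: True
    define f where "f = L $$ (n mod q, b)"
    \<comment> \<open>\<open>g l\<close> is the index with residue \<open>b\<close> that lies
      \<open>l\<close> blocks beyond the block of \<open>n\<close>.\<close>
    define g where "g l = (n div q + l) * q + b" for l
    have g: "g l div q = n div q + l" "g l mod q = b" for l
      using q b by (auto simp: g_def)
    have inj: "inj_on g {..degree f}"
      by (rule inj_onI) (metis g(1) add_left_cancel)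
    have "(block_toeplitz q L \<odot> Xmon q x) n b
        = (\<Sum>m\<in>g ` {..degree f}. block_toeplitz q L n m * Xmon q x m b)"
    proof (rule smult_mat_eq_sum)
      fix m assume m: "m \<notin> g ` {..degree f}"
      show "block_toeplitz q L n m * Xmon q x m b = 0"
      proof (rule ccontr)
        assume "block_toeplitz q L n m * Xmon q x m b \<noteq> 0"
        then have mb: "m mod q = b" and le: "n div q \<le> m div q"
          and "coeff f (m div q - n div q) \<noteq> 0"
          by (auto simp: block_toeplitz_def Xmon_def f_def split: if_splits)
        then have "m div q - n div q \<le> degree f" by (simp add: le_degree)
        moreover have "m = g (m div q - n div q)"
          using mb le by (auto simp: g_def)
        ultimately show False using m by blast
      qed
    qed simp
    also have "\<dots> = (\<Sum>l\<le>degree f. coeff f l * x ^ (n div q + l))"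
      by (subst sum.reindex[OF inj]) (simp add: block_toeplitz_def Xmon_def g f_def)
    also have "\<dots> = x ^ (n div q) * poly f x"
      by (simp add: poly_altdef sum_distrib_left power_add ac_simps)
    also have "\<dots> = (Xmon q x \<odot> smat_of_mat q (eval_mat L x)) n b"
      using L q b by (simp add: Xmon_smult_mat smat_of_mat_def eval_mat_def f_def)
    finally show ?thesis .
  next
    case False
    then have "Xmon q x m b = 0" for m using q by (auto simp: Xmon_def)
    then have "(block_toeplitz q L \<odot> Xmon q x) n b = 0"
      by (simp add: smult_mat_def)
    then show ?thesis using False q by (simp add: Xmon_smult_mat smat_of_mat_def)
  qed
qed

section \<open>Moments of the perturbed measure\<close>

lemma set_integrable_sum:
  assumes "\<And>i. i \<in> I \<Longrightarrow> set_integrable M A (f i)"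
  shows "set_integrable M A (\<lambda>x. \<Sum>i\<in>I. f i x)"
  using assms unfolding set_integrable_def scaleR_sum_right by (rule Bochner_Integration.integrable_sum)

lemma set_integral_sum:
  assumes "\<And>i. i \<in> I \<Longrightarrow> set_integrable M A (f i)"
  shows "(LINT x:A|M. \<Sum>i\<in>I. f i x) = (\<Sum>i\<in>I. LINT x:A|M. f i x)"
  using assms unfolding set_integrable_def set_lebesgue_integral_def scaleR_sum_right
  by (rule Bochner_Integration.integral_sum)

lemma integrable_moment:
  assumes w: "matrix_measure q p \<Delta> \<nu> w" and "c < q" "a < p"
  shows "set_integrable \<nu> \<Delta>
    (\<lambda>x. Xmon q (complex_of_real x) n c * w c a x * Xmon p (complex_of_real x) m a)"
proof -
  have "\<Delta> \<in> sets \<nu>" using w by (simp add: matrix_measure_def)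
  moreover have "integrable \<nu> (\<lambda>x. complex_of_real x ^ (n div q + m div p) * w c a x)"
    using assms by (simp add: matrix_measure_def)
  then have "integrable \<nu>
      (\<lambda>x. Xmon q (complex_of_real x) n c * w c a x * Xmon p (complex_of_real x) m a)"
    by (cases "n mod q = c"; cases "m mod p = a") (simp_all add: Xmon_def power_add ac_simps)
  ultimately show ?thesis
    unfolding set_integrable_def by (rule integrable_mult_indicator)
qed

text \<open>The perturbed integrand contains \<open>X L = J X\<close>. Rows of \<open>J\<close> are
  finite, so \<open>J\<close> leaves the integral as a finite linear combination of integrable
  terms.\<close>

lemma moment_matrix_left_perturb:
  assumes w: "matrix_measure q p \<Delta> \<nu> w" and L: "L \<in> carrier_mat q q" and q: "q > 0"
    and fin: "row_finite (block_toeplitz q L)"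
  shows "moment_matrix q p \<Delta> \<nu> (left_perturb q L w) = block_toeplitz q L \<odot> moment_matrix q p \<Delta> \<nu> w"
proof (intro ext)
  fix n m
  define K where "K = {k. block_toeplitz q L n k \<noteq> 0}"
  have finK: "finite K" using fin by (simp add: K_def row_finite_def)
  define F where "F k x = (\<Sum>c<q. \<Sum>a<p.
    Xmon q (complex_of_real x) k c * w c a x * Xmon p (complex_of_real x) m a)" for k x
  have intF: "set_integrable \<nu> \<Delta> (F k)" for k
    unfolding F_def by (intro set_integrable_sum integrable_moment[OF w]) auto
  have XL: "(\<Sum>b<q. Xmon q z n b * eval_mat L z $$ (b, c))
      = (\<Sum>k\<in>K. block_toeplitz q L n k * Xmon q z k c)" if "c < q" for z c
  proof -
    have "(\<Sum>b<q. Xmon q z n b * eval_mat L z $$ (b, c))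
        = (Xmon q z \<odot> smat_of_mat q (eval_mat L z)) n c"
      using that q by (subst smult_mat_eq_sum[where K = "{..<q}"]) (auto simp: smat_of_mat_def)
    also have "\<dots> = (\<Sum>k\<in>K. block_toeplitz q L n k * Xmon q z k c)"
      unfolding block_toeplitz_Xmon[OF L q, symmetric]
      by (rule smult_mat_eq_sum[OF finK]) (simp add: K_def)
    finally show ?thesis .
  qed
  have eq: "(\<Sum>b<q. \<Sum>a<p. Xmon q (complex_of_real x) n b * left_perturb q L w b a x
      * Xmon p (complex_of_real x) m a) = (\<Sum>k\<in>K. block_toeplitz q L n k * F k x)" for x
  proof -
    let ?z = "complex_of_real x"
    have "(\<Sum>b<q. \<Sum>a<p. Xmon q ?z n b * left_perturb q L w b a x * Xmon p ?z m a)
        = (\<Sum>b<q. \<Sum>a<p. \<Sum>c<q. Xmon q ?z n b * eval_mat L ?z $$ (b, c) * w c a x * Xmon p ?z m a)"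
      by (simp add: left_perturb_def sum_distrib_left sum_distrib_right mult.assoc)
    also have "\<dots> = (\<Sum>b<q. \<Sum>c<q. \<Sum>a<p. Xmon q ?z n b * eval_mat L ?z $$ (b, c) * w c a x * Xmon p ?z m a)"
      by (intro sum.cong refl sum.swap)
    also have "\<dots> = (\<Sum>c<q. \<Sum>b<q. \<Sum>a<p. Xmon q ?z n b * eval_mat L ?z $$ (b, c) * w c a x * Xmon p ?z m a)"
      by (rule sum.swap)
    also have "\<dots> = (\<Sum>c<q. (\<Sum>b<q. Xmon q ?z n b * eval_mat L ?z $$ (b, c)) * (\<Sum>a<p. w c a x * Xmon p ?z m a))"
      by (simp add: sum_product mult.assoc)
    also have "\<dots> = (\<Sum>c<q. (\<Sum>k\<in>K. block_toeplitz q L n k * Xmon q ?z k c) * (\<Sum>a<p. w c a x * Xmon p ?z m a))"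
      by (intro sum.cong refl) (simp add: XL)
    also have "\<dots> = (\<Sum>c<q. \<Sum>k\<in>K. block_toeplitz q L n k * (\<Sum>a<p. Xmon q ?z k c * w c a x * Xmon p ?z m a))"
      by (intro sum.cong refl, simp only: sum_product) (simp only: sum_distrib_left mult.assoc)
    also have "\<dots> = (\<Sum>k\<in>K. block_toeplitz q L n k * F k x)"
      by (subst sum.swap) (simp add: F_def sum_distrib_left)
    finally show ?thesis .
  qed
  have "moment_matrix q p \<Delta> \<nu> (left_perturb q L w) n m
      = (LINT x:\<Delta>|\<nu>. (\<Sum>k\<in>K. block_toeplitz q L n k * F k x))"
    by (simp only: moment_matrix_def eq)
  also have "\<dots> = (\<Sum>k\<in>K. LINT x:\<Delta>|\<nu>. block_toeplitz q L n k * F k x)"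
    by (simp add: set_integral_sum set_integrable_mult_right intF)
  also have "\<dots> = (\<Sum>k\<in>K. block_toeplitz q L n k * moment_matrix q p \<Delta> \<nu> w k m)"
    by (simp add: moment_matrix_def F_def)
  also have "\<dots> = (block_toeplitz q L \<odot> moment_matrix q p \<Delta> \<nu> w) n m"
    by (rule smult_mat_eq_sum[OF finK, symmetric]) (simp add: K_def)
  finally show "moment_matrix q p \<Delta> \<nu> (left_perturb q L w) n m
      = (block_toeplitz q L \<odot> moment_matrix q p \<Delta> \<nu> w) n m" .
qed

section \<open>Comparison of two Gauss--Borel factorizations\<close>

lemma row_finite_smult_mat:
  assumes "row_finite A" "row_finite B"
  shows "row_finite (A \<odot> B)"
  unfolding row_finite_def
proof
  fix n
  have "{m. (A \<odot> B) n m \<noteq> 0} \<subseteq> (\<Union>k\<in>{k. A n k \<noteq> 0}. {m. B k m \<noteq> 0})"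
  proof (rule subsetI, rule ccontr)
    fix m assume m: "m \<in> {m. (A \<odot> B) n m \<noteq> 0}"
      and "m \<notin> (\<Union>k\<in>{k. A n k \<noteq> 0}. {m. B k m \<noteq> 0})"
    then have "A n k * B k m = 0" for k by auto
    then have "(A \<odot> B) n m = 0" by (subst smult_mat_eq_sum[where K = "{}"]) simp_all
    then show False using m by simp
  qed
  then show "finite {m. (A \<odot> B) n m \<noteq> 0}"
    by (rule finite_subset) (use assms in \<open>auto simp: row_finite_def\<close>)
qed

lemma unitriangular_inverse_row_finite:
  assumes "unitriangular_inverse S T"
  shows "row_finite S" "row_finite T"
  using assms by (auto simp: unitriangular_inverse_def
      intro!: upper_bandwidth_imp_row_finite lower_unitriangular_bandwidth)

lemma unitriangular_inverse_cancel:
  assumes "unitriangular_inverse S T"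
  shows "S \<odot> (T \<odot> C) = C" "T \<odot> (S \<odot> C) = C"
proof -
  note unitriangular_inverse_row_finite[OF assms]
  then show "S \<odot> (T \<odot> C) = C" "T \<odot> (S \<odot> C) = C"
    using assms by (simp_all only: unitriangular_inverse_def smult_mat_assoc[symmetric] sdiag_one_smult_mat)
qed

lemma sdiag_cancel:
  assumes "\<And>n. d n \<noteq> 0"
  shows "sdiag (\<lambda>n. 1 / d n) \<odot> (sdiag d \<odot> C) = C" "sdiag d \<odot> (sdiag (\<lambda>n. 1 / d n) \<odot> C) = C"
  by (intro ext; simp add: assms)+

lemma row_finite_sdiag: "row_finite (sdiag d)"
  using upper_bandwidth_sdiag by (rule upper_bandwidth_imp_row_finite)

text \<open>Two expressions for \<open>\<Omega>\<close> share the work: its definition gives the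
  band and the relation between the \<open>B\<close>'s, while \<open>\<Omega>T\<close> gives
  unitriangularity and the relation between the \<open>A\<close>'s.\<close>

lemma gauss_borel_connection:
  assumes meas: "matrix_measure q p \<Delta> \<nu> w" and L: "L \<in> carrier_mat q q" and q: "q > 0"
    and band: "upper_bandwidth M (block_toeplitz q L)"
    and top: "\<And>n. block_toeplitz q L n (n + M) = 1"
    and GB: "gauss_borel (moment_matrix q p \<Delta> \<nu> w) S H Sb"
    and GB': "gauss_borel (moment_matrix q p \<Delta> \<nu> (left_perturb q L w)) S' H' Sb'"
  obtains \<Omega> where "upper_bandwidth M \<Omega>" "\<And>n. \<Omega> n (n + M) \<noteq> 0"
    "lower_unitriangular (stranspose \<Omega>)"
    "\<And>x. \<Omega> \<odot> Bfam q S H x = Bfam q S' H' x \<odot> smat_of_mat q (eval_mat L x)"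
    "\<And>x. Afam p Sb' x \<odot> \<Omega> = Afam p Sb x"
proof -
  define J where "J = block_toeplitz q L"
  have fin: "row_finite J"
    using band unfolding J_def by (rule upper_bandwidth_imp_row_finite)
  obtain T Tb where H: "\<And>n. H n \<noteq> 0" and T: "unitriangular_inverse S T"
    and Tb: "unitriangular_inverse Sb Tb"
    and Mm: "moment_matrix q p \<Delta> \<nu> w = T \<odot> sdiag H \<odot> stranspose Tb"
    using GB by (auto simp: gauss_borel_def)
  obtain T' Tb' where H': "\<And>n. H' n \<noteq> 0" and T': "unitriangular_inverse S' T'"
    and Tb': "unitriangular_inverse Sb' Tb'"
    and Mm': "moment_matrix q p \<Delta> \<nu> (left_perturb q L w) = T' \<odot> sdiag H' \<odot> stranspose Tb'"
    using GB' by (auto simp: gauss_borel_def)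
  note rf = unitriangular_inverse_row_finite[OF T] unitriangular_inverse_row_finite[OF T']
    unitriangular_inverse_row_finite[OF Tb] unitriangular_inverse_row_finite[OF Tb']
    fin row_finite_sdiag row_finite_Xmon row_finite_smult_mat
  note cancel = unitriangular_inverse_cancel[OF T] unitriangular_inverse_cancel[OF T']
    unitriangular_inverse_cancel[OF Tb] unitriangular_inverse_cancel[OF Tb']
    sdiag_cancel[OF H] sdiag_cancel[OF H']
  \<comment> \<open>\<open>T \<odot> sdiag H\<close> cancels the factor
    \<open>H\<^sup>-\<^sup>1 S\<close> of \<open>Bfam\<close>, so \<open>\<Omega>\<close> sends
    \<open>B\<close> to \<open>H'\<^sup>-\<^sup>1 S' J X\<close>, which is
    \<open>B' L\<close>.\<close>
  define \<Omega> where "\<Omega> = sdiag (\<lambda>n. 1 / H' n) \<odot> (S' \<odot> (J \<odot> (T \<odot> sdiag H)))"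
  have JM: "J \<odot> (T \<odot> (sdiag H \<odot> stranspose Tb)) = T' \<odot> (sdiag H' \<odot> stranspose Tb')"
    using moment_matrix_left_perturb[OF meas L q fin[unfolded J_def]]
    by (simp add: Mm Mm' J_def smult_mat_assoc rf)
  have "\<Omega> \<odot> stranspose Tb = stranspose Tb'"
    by (simp add: \<Omega>_def smult_mat_assoc rf JM cancel)
  \<comment> \<open>Right multiplication by \<open>stranspose Sb\<close> undoes
    \<open>stranspose Tb\<close>. Both are upper triangular, hence the column version of
    associativity.\<close>
  moreover have "\<Omega> = (\<Omega> \<odot> stranspose Tb) \<odot> stranspose Sb"
  proof -
    have "stranspose Tb \<odot> stranspose Sb = stranspose (sdiag (\<lambda>_. 1))"
      using Tb by (simp add: unitriangular_inverse_def flip: stranspose_smult_mat)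
    also have "\<dots> = sdiag (\<lambda>_. 1)" by (auto simp: stranspose_def sdiag_def fun_eq_iff)
    finally show ?thesis by (simp add: smult_mat_assoc_col rf)
  qed
  ultimately have \<Omega>T: "stranspose \<Omega> = Sb \<odot> Tb'"
    by (metis stranspose_smult_mat stranspose_stranspose)
  have low: "lower_unitriangular S'" "lower_unitriangular T" "lower_unitriangular Sb"
    "lower_unitriangular Tb'"
    using T T' Tb Tb' by (auto simp: unitriangular_inverse_def)
  note bw = low(1,2)[THEN lower_unitriangular_bandwidth] upper_bandwidth_sdiag
  \<comment> \<open>The triangular and diagonal factors have bandwidth 0, so only \<open>J\<close>
    contributes \<open>M\<close>. The outermost entry of row \<open>n\<close> of
    \<open>\<Omega>\<close> comes out as \<open>H (n + M) / H' n\<close>.\<close>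
  note b1 = smult_mat_banded[OF bw(2) bw(3)[of H]]
  note b2 = smult_mat_banded[OF band[folded J_def] b1(1)]
  note b3 = smult_mat_banded[OF bw(1) b2(1)]
  have "upper_bandwidth M \<Omega>"
    using smult_mat_banded(1)[OF bw(3) b3(1)] by (simp add: \<Omega>_def)
  moreover have "\<Omega> n (n + M) \<noteq> 0" for n
    using b3(2)[of n] b2(2)[of n] b1(2)[of "n + M"] top[of n] low H H'
    by (simp add: \<Omega>_def J_def lower_unitriangular_def)
  moreover have "lower_unitriangular (stranspose \<Omega>)"
    unfolding \<Omega>T using low by (intro lower_unitriangular_smult_mat)
  moreover have "\<Omega> \<odot> Bfam q S H x = Bfam q S' H' x \<odot> smat_of_mat q (eval_mat L x)" for x
    by (simp add: \<Omega>_def Bfam_def smult_mat_assoc rf cancel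
        flip: block_toeplitz_Xmon[OF L q, folded J_def])
  moreover have "Afam p Sb' x \<odot> \<Omega> = Afam p Sb x" for x
  proof -
    have "stranspose \<Omega> \<odot> (Sb' \<odot> Xmon p x) = Sb \<odot> Xmon p x"
      by (simp add: \<Omega>T smult_mat_assoc rf cancel)
    then show ?thesis
      by (metis Afam_def stranspose_smult_mat stranspose_stranspose)
  qed
  ultimately show ?thesis by (rule that)
qed

section \<open>Shape of the leading coefficients of \<open>L\<close>\<close>

text \<open>For \<open>n = k * q + c\<close> and \<open>m = (k + l) * q + b\<close>, the condition
  \<open>n + M < m\<close> reads \<open>N * q + c < l * q + b + r\<close>. It rules out
  \<open>l + 2 \<le> N\<close>. For \<open>l = N\<close> it gives \<open>c < b + r\<close>, while
  the ones of \<open>Lc N\<close> sit at \<open>c = b + r\<close>. For \<open>l = N - 1\<close> it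
  forces the entry into the identity block, strictly above the diagonal, out of reach of the
  arbitrary blocks.\<close>

lemma block_toeplitz_poly_mat_banded:
  assumes dims: "q \<ge> 1" "N \<ge> 1" "r \<le> q - 1" and M: "M = N * q - r"
    and Lblocks: "L1 \<in> carrier_mat r (q - r)" "L3 \<in> carrier_mat (q - r) (q - r)"
      "L4 \<in> carrier_mat (q - r) r"
    and LN: "Lc N = four_block_mat (0\<^sub>m r (q - r)) (0\<^sub>m r r) (1\<^sub>m (q - r)) (0\<^sub>m (q - r) r)"
    and LN1: "Lc (N - 1) = four_block_mat L1 (1\<^sub>m r) L3 L4"
  shows "upper_bandwidth M (block_toeplitz q (poly_mat q N Lc))"
    and "block_toeplitz q (poly_mat q N Lc) n (n + M) = 1"
proof -
  have r: "r < q" using dims by linarith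
  have NN: "q \<le> N * q" "(N - 1) * q = N * q - q"
    using dims by (simp_all add: diff_mult_distrib)
  have coef: "coeff (poly_mat q N Lc $$ (c, b)) l = (if l \<le> N then Lc l $$ (c, b) else 0)"
    if "c < q" "b < q" for c b l
    using that by (simp add: poly_mat_def coeff_sum)
  have N: "Lc N $$ (c, b) = (if r \<le> c \<and> b = c - r then 1 else 0)" if "c < q" "b < q" for c b
    using that r by (auto simp: LN)
  have N1: "Lc (N - 1) $$ (c, b) = (if b = c + (q - r) then 1 else 0)"
    if "c < r" "q - r \<le> b" "b < q" for c b
    using that r Lblocks by (auto simp: LN1[simplified])
  show "upper_bandwidth M (block_toeplitz q (poly_mat q N Lc))"
    unfolding upper_bandwidth_def
  proof (intro allI impI)
    fix n m assume nm: "n + M < m"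
    define k c b where "k = n div q" and "c = n mod q" and "b = m mod q"
    have cb: "c < q" "b < q" using r by (auto simp: c_def b_def)
    show "block_toeplitz q (poly_mat q N Lc) n m = 0"
    proof (cases "k \<le> m div q \<and> m div q - k \<le> N")
      case True
      define l where "l = m div q - k"
      have l: "m div q = k + l" "l \<le> N" using True by (auto simp: l_def)
      have n: "n = k * q + c" unfolding k_def c_def by simp
      have m: "m = k * q + l * q + b"
        unfolding b_def using l(1) by (metis add_mult_distrib div_mult_mod_eq)
      have ineq: "N * q + c < l * q + b + r"
        using nm M NN r unfolding n m by linarith
      have eq: "block_toeplitz q (poly_mat q N Lc) n m = Lc l $$ (c, b)"
        using l cb by (simp add: block_toeplitz_def coef flip: k_def c_def b_def)
      consider "l = N" | "l = N - 1" | "l + 2 \<le> N" using l(2) by linarith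
      then show ?thesis
      proof cases
        case 1
        then show ?thesis using ineq cb by (auto simp: eq N)
      next
        case 2
        then have "l * q = N * q - q" using NN by simp
        then have "c + q < b + r" using ineq NN(1) by linarith
        then show ?thesis using cb r unfolding eq 2 by (subst N1) auto
      next
        case 3
        then have "l * q + 2 * q \<le> N * q" by (metis add_mult_distrib mult_le_mono1)
        then show ?thesis using ineq cb r by linarith
      qed
    next
      case False
      then show ?thesis using cb
        by (auto simp: block_toeplitz_def coef simp flip: k_def c_def b_def)
    qed
  qed
  define k c where "k = n div q" and "c = n mod q"
  have c: "c < q" using r by (auto simp: c_def)
  have n: "n = k * q + c" unfolding k_def c_def by simp
  show "block_toeplitz q (poly_mat q N Lc) n (n + M) = 1"
  \<comment> \<open>Rows \<open>c \<ge> r\<close> of a block end in the identity of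
    \<open>Lc N\<close>, the first \<open>r\<close> rows in the identity of
    \<open>Lc (N - 1)\<close>.\<close>
  proof (cases "r \<le> c")
    case True
    have nM: "n + M = (k + N) * q + (c - r)"
      unfolding n add_mult_distrib using True M NN r by linarith
    have "(n + M) div q = k + N" "(n + M) mod q = c - r"
      unfolding nM using c by auto
    then show ?thesis
      using c True by (simp add: block_toeplitz_def coef N flip: k_def c_def)
  next
    case False
    have nM: "n + M = (k + (N - 1)) * q + (c + (q - r))"
      unfolding n add_mult_distrib using False M NN r by linarith
    have "(n + M) div q = k + (N - 1)" "(n + M) mod q = c + (q - r)"
      unfolding nM using c False r by (simp_all only: div_mult_self3 mod_mult_self3) auto
    then show ?thesis
      using c False r N1[of c "c + (q - r)"]
      by (simp add: block_toeplitz_def coef flip: k_def c_def)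
  qed
qed

section \<open>Row operations on determinants\<close>

text \<open>Laplace expansion: the cofactors of the first row do not see that row, so one
  \<open>C\<close> serves every \<open>u\<close>. The value of \<open>C 0\<close> settles the case
  of a first row supported in column 0.\<close>

lemma det_first_row:
  fixes W :: "nat \<Rightarrow> nat \<Rightarrow> 'a :: comm_ring_1"
  obtains C where
    "\<And>u. det (mat (Suc n) (Suc n) (\<lambda>(j,i). if j = 0 then u i else W j i)) = (\<Sum>i<Suc n. u i * C i)"
    "C 0 = det (mat n n (\<lambda>(j,i). W (Suc j) (Suc i)))"
proof -
  define A where "A u = mat (Suc n) (Suc n) (\<lambda>(j,i). if j = 0 then u i else W j i)" for u
  have del: "mat_delete (A u) 0 i = mat n n (\<lambda>(j,k). W (Suc j) (if k < i then k else Suc k))" for u i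
    by (rule eq_matI) (auto simp: A_def mat_delete_def)
  show ?thesis
  proof
    fix u
    have "det (A u) = (\<Sum>i<Suc n. A u $$ (0, i) * cofactor (A u) 0 i)"
      by (rule laplace_expansion_row) (auto simp: A_def)
    then show "det (mat (Suc n) (Suc n) (\<lambda>(j,i). if j = 0 then u i else W j i))
      = (\<Sum>i<Suc n. u i * cofactor (A (\<lambda>_. 0)) 0 i)"
      by (simp add: cofactor_def del) (simp add: A_def)
  qed (simp add: cofactor_def del)
qed

text \<open>Pairing the first-row cofactors with a lower row \<open>W j\<close> gives a determinant
  with two equal rows, hence 0.\<close>

lemma det_first_row_combination:
  fixes W :: "nat \<Rightarrow> nat \<Rightarrow> 'a :: comm_ring_1"
  assumes n: "n > 0"
    and u: "\<And>i. i < n \<Longrightarrow> u i = \<alpha> * u' i + (\<Sum>j\<in>{1..<n}. c j * W j i)"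
  shows "det (mat n n (\<lambda>(j,i). if j = 0 then u i else W j i))
    = \<alpha> * det (mat n n (\<lambda>(j,i). if j = 0 then u' i else W j i))"
proof -
  obtain m where m: "n = Suc m" using n by (cases n) auto
  obtain C where
    C: "\<And>u. det (mat n n (\<lambda>(j,i). if j = 0 then u i else W j i)) = (\<Sum>i<n. u i * C i)"
    and "C 0 = det (mat m m (\<lambda>(j,i). W (Suc j) (Suc i)))"
    unfolding m by (rule det_first_row[of m W]) blast
  have zero: "(\<Sum>i<n. W j i * C i) = 0" if j: "j \<in> {1..<n}" for j
    unfolding C[symmetric]
    by (rule det_identical_rows[of _ n 0 j]) (use j in \<open>auto intro!: eq_vecI\<close>)
  have "(\<Sum>i<n. u i * C i)
      = \<alpha> * (\<Sum>i<n. u' i * C i) + (\<Sum>i<n. \<Sum>j\<in>{1..<n}. c j * (W j i * C i))"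
    by (simp add: u distrib_right sum.distrib sum_distrib_left sum_distrib_right mult.assoc)
  also have "(\<Sum>i<n. \<Sum>j\<in>{1..<n}. c j * (W j i * C i)) = 0"
    by (subst sum.swap) (simp add: zero flip: sum_distrib_left)
  finally show ?thesis by (simp add: C)
qed

section \<open>Nonvanishing of \<open>\<tau>\<close>\<close>

text \<open>A nonzero \<open>\<Omega> n (n + M)\<close> lets the recurrence be solved for its last
  term, which carries the zeros upwards; a nonzero \<open>\<Omega> n n\<close> lets it be solved for
  its first term, which carries them downwards.\<close>

lemma recurrence_zero:
  fixes g :: "nat \<Rightarrow> complex"
  assumes rec: "\<And>n. (\<Sum>k\<in>{n..n + M}. \<Omega> n k * g k) = 0"
    and diag: "\<And>n. \<Omega> n n \<noteq> 0" and top: "\<And>n. \<Omega> n (n + M) \<noteq> 0"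
    and window: "\<And>j. j < M \<Longrightarrow> g (n0 + j) = 0"
  shows "g m = 0"
proof -
  have up: "g m = 0" if "m \<ge> n0" for m
    using that
  proof (induction m rule: less_induct)
    case (less m)
    show ?case
    proof (cases "m < n0 + M")
      case True
      then show ?thesis using window[of "m - n0"] less.prems by simp
    next
      case False
      define n where "n = m - M"
      have n: "m = n + M" "n \<ge> n0" using False by (auto simp: n_def)
      have "(\<Sum>k\<in>{n..n + M}. \<Omega> n k * g k) = \<Omega> n m * g m + (\<Sum>k\<in>{n..n + M} - {m}. \<Omega> n k * g k)"
        using n by (intro sum.remove) auto
      also have "(\<Sum>k\<in>{n..n + M} - {m}. \<Omega> n k * g k) = 0"
        using n by (intro sum.neutral) (auto intro!: less.IH)
      finally show ?thesis using rec[of n] top[of n] n by simp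
    qed
  qed
  \<comment> \<open>Downward induction; the subtraction is truncated, so \<open>d = n0\<close>
    reaches all indices.\<close>
  have "\<forall>m\<ge>n0 - d. g m = 0" for d
  proof (induction d)
    case 0
    then show ?case using up by simp
  next
    case (Suc d)
    define n where "n = n0 - Suc d"
    have later: "g m = 0" if "m > n" for m
      using Suc that up by (cases "d < n0") (auto simp: n_def)
    have "(\<Sum>k\<in>{n..n + M}. \<Omega> n k * g k) = \<Omega> n n * g n + (\<Sum>k\<in>{n..n + M} - {n}. \<Omega> n k * g k)"
      by (intro sum.remove) auto
    also have "(\<Sum>k\<in>{n..n + M} - {n}. \<Omega> n k * g k) = 0"
      by (intro sum.neutral) (auto intro!: later)
    finally have "g n = 0" using rec[of n] diag[of n] by simp
    then show ?case using later unfolding n_def[symmetric] by (metis le_neq_implies_less)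
  qed
  from this[of n0] show ?thesis by simp
qed

text \<open>Vandermonde independence, by testing against the polynomial \<open>f\<close> that
  vanishes at every node except \<open>y i\<close>.\<close>

lemma power_sums_zero_imp_zero:
  fixes y d :: "nat \<Rightarrow> complex"
  assumes inj: "inj_on y {..<M}" and sums: "\<And>k. (\<Sum>i<M. d i * y i ^ k) = 0" and i: "i < M"
  shows "d i = 0"
proof -
  define f where "f = (\<Prod>j\<in>{..<M} - {i}. [:- y j, 1:])"
  have "(\<Sum>j<M. d j * poly f (y j)) = (\<Sum>j<M. \<Sum>k\<le>degree f. coeff f k * (d j * y j ^ k))"
    by (simp add: poly_altdef sum_distrib_left ac_simps)
  also have "\<dots> = 0"
    by (subst sum.swap) (simp add: sums flip: sum_distrib_left)
  finally have "(\<Sum>j<M. d j * poly f (y j)) = 0" .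
  moreover have "(\<Sum>j<M. d j * poly f (y j)) = d i * poly f (y i)"
    using i by (subst sum.remove[where x = i]) (auto simp: f_def poly_prod intro!: sum.neutral)
  moreover have "poly f (y i) \<noteq> 0"
    using inj i by (auto simp: f_def poly_prod inj_on_def)
  ultimately show ?thesis by simp
qed

text \<open>A kernel vector \<open>c\<close> of the window gives a combination \<open>g\<close> of
  the columns that solves the recurrence and vanishes at \<open>M\<close> consecutive indices, hence
  everywhere.\<close>

lemma window_det_nonzero:
  fixes F :: "nat \<Rightarrow> nat \<Rightarrow> complex"
  assumes rec: "\<And>n i. i < M \<Longrightarrow> (\<Sum>k\<in>{n..n + M}. \<Omega> n k * F k i) = 0"
    and diag: "\<And>n. \<Omega> n n \<noteq> 0" and top: "\<And>n. \<Omega> n (n + M) \<noteq> 0"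
    and indep: "\<And>c i. (\<And>m. (\<Sum>i<M. c i * F m i) = 0) \<Longrightarrow> i < M \<Longrightarrow> c i = 0"
  shows "det (mat M M (\<lambda>(j,i). F (n + j) i)) \<noteq> 0"
proof
  let ?A = "mat M M (\<lambda>(j,i). F (n + j) i)"
  assume "det ?A = 0"
  then obtain c where c: "c \<in> carrier_vec M" "c \<noteq> 0\<^sub>v M" "?A *\<^sub>v c = 0\<^sub>v M"
    using det_0_iff_vec_prod_zero[of ?A M] by auto
  define g where "g m = (\<Sum>i<M. c $ i * F m i)" for m
  have window: "g (n + j) = 0" if "j < M" for j
  proof -
    have "(?A *\<^sub>v c) $ j = g (n + j)"
      using that c(1) by (simp add: scalar_prod_def g_def atLeast0LessThan mult.commute)
    then show ?thesis using that c(3) by simp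
  qed
  have "(\<Sum>k\<in>{m..m + M}. \<Omega> m k * g k) = 0" for m
  proof -
    have "(\<Sum>k\<in>{m..m + M}. \<Omega> m k * g k) = (\<Sum>i<M. c $ i * (\<Sum>k\<in>{m..m + M}. \<Omega> m k * F k i))"
      unfolding g_def sum_distrib_left by (subst sum.swap) (simp add: mult.left_commute)
    then show ?thesis by (simp add: rec)
  qed
  then have "g m = 0" for m
    using diag top window by (rule recurrence_zero)
  then have "c $ i = 0" if "i < M" for i
    using indep[of "\<lambda>i. c $ i"] that unfolding g_def by blast
  then have "c = 0\<^sub>v M" using c(1) by (intro eq_vecI) auto
  with c(2) show False by blast
qed

text \<open>Each row of \<open>Xmon\<close> is a finite combination of rows of \<open>Bfam\<close>,
  with coefficients independent of the point, so the relation passes to the monomials.\<close>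

lemma Bfam_eigenvalues_independent:
  fixes y c :: "nat \<Rightarrow> complex" and v :: "nat \<Rightarrow> complex vec"
  assumes GB: "gauss_borel Mm S H Sb" and q: "q > 0"
    and inj: "inj_on y {..<M}"
    and v: "\<And>i. i < M \<Longrightarrow> v i \<in> carrier_vec q" "\<And>i. i < M \<Longrightarrow> v i \<noteq> 0\<^sub>v q"
    and zero: "\<And>m. (\<Sum>i<M. c i * (\<Sum>b<q. Bfam q S H (y i) m b * v i $ b)) = 0"
    and i: "i < M"
  shows "c i = 0"
proof -
  obtain T where H: "\<And>n. H n \<noteq> 0" and T: "unitriangular_inverse S T"
    using GB by (auto simp: gauss_borel_def)
  note rf = unitriangular_inverse_row_finite[OF T] row_finite_sdiag row_finite_smult_mat
  have X: "Xmon q z = (T \<odot> sdiag H) \<odot> Bfam q S H z" for z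
    by (simp add: Bfam_def smult_mat_assoc rf unitriangular_inverse_cancel[OF T] sdiag_cancel[OF H])
  define K where "K n = {k. (T \<odot> sdiag H) n k \<noteq> 0}" for n
  have fin: "finite (K n)" for n
    using rf by (simp add: K_def row_finite_def[symmetric]) (simp add: row_finite_def)
  have Xmon: "Xmon q z n b = (\<Sum>k\<in>K n. (T \<odot> sdiag H) n k * Bfam q S H z k b)" for z n b
    unfolding X[of z] by (rule smult_mat_eq_sum[OF fin]) (simp add: K_def)
  have vec: "(\<Sum>i<M. c i * (\<Sum>b<q. Xmon q (y i) n b * v i $ b)) = 0" for n
  proof -
    have "(\<Sum>i<M. c i * (\<Sum>b<q. Xmon q (y i) n b * v i $ b))
        = (\<Sum>i<M. \<Sum>b<q. \<Sum>k\<in>K n. (T \<odot> sdiag H) n k * (c i * (Bfam q S H (y i) k b * v i $ b)))"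
      unfolding Xmon by (simp add: sum_distrib_left sum_distrib_right ac_simps)
    also have "\<dots> = (\<Sum>i<M. \<Sum>k\<in>K n. \<Sum>b<q. (T \<odot> sdiag H) n k * (c i * (Bfam q S H (y i) k b * v i $ b)))"
      by (intro sum.cong refl sum.swap)
    also have "\<dots> = (\<Sum>k\<in>K n. \<Sum>i<M. \<Sum>b<q. (T \<odot> sdiag H) n k * (c i * (Bfam q S H (y i) k b * v i $ b)))"
      by (rule sum.swap)
    also have "\<dots> = (\<Sum>k\<in>K n. (T \<odot> sdiag H) n k * (\<Sum>i<M. c i * (\<Sum>b<q. Bfam q S H (y i) k b * v i $ b)))"
      by (simp add: sum_distrib_left)
    also have "\<dots> = 0" by (simp only: zero) simp
    finally show ?thesis .
  qed
  \<comment> \<open>Only \<open>v i\<close> needs a nonzero component here: rows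
    \<open>k * q + b\<close> give vanishing power sums with weights \<open>c j * v j $ b\<close>, of
    which the one at \<open>j = i\<close> is then cancelled.\<close>
  obtain b where b: "b < q" "v i $ b \<noteq> 0"
    using v[OF i] by (metis carrier_vecD eq_vecI index_zero_vec)
  have "(\<Sum>i<M. (c i * v i $ b) * y i ^ k) = 0" for k
  proof -
    have "(\<Sum>b'<q. Xmon q (y i) (k * q + b) b' * v i $ b') = y i ^ k * v i $ b" for i
      using b(1) by (subst sum.remove[where x = b]) (auto simp: Xmon_def intro!: sum.neutral)
    then show ?thesis using vec[of "k * q + b"] by (simp add: ac_simps)
  qed
  from power_sums_zero_imp_zero[OF inj, of "\<lambda>i. c i * v i $ b", OF this i] show ?thesis using b(2) by simp
qed

section \<open>The two Christoffel formulas\<close>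

text \<open>Both determinants are evaluated by a row operation: modulo the lower rows, the first row is
  \<open>A' (n - 1)\<close> times the first row of \<open>\<tau> (n - 1)\<close>, respectively the row
  \<open>((B' L) n, 0, \<dots>, 0)\<close>.\<close>

theorem theorem4p15:
  fixes p q N r M :: nat
    and \<Delta> :: "real set" and \<nu> :: "real measure" and w :: "nat \<Rightarrow> nat \<Rightarrow> real \<Rightarrow> complex"
    and S Sb S' Sb' :: smat and H H' :: "nat \<Rightarrow> complex"
    and Lc :: "nat \<Rightarrow> complex mat" and L1 L3 L4 :: "complex mat" and L :: "complex poly mat"
    and y :: "nat \<Rightarrow> complex" and v :: "nat \<Rightarrow> complex vec"
    and A B A' B' :: "complex \<Rightarrow> smat"
    and \<BB> :: "nat \<Rightarrow> nat \<Rightarrow> complex" and \<KK> :: "nat \<Rightarrow> nat \<Rightarrow> complex \<Rightarrow> nat \<Rightarrow> complex"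
    and \<tau> :: "nat \<Rightarrow> complex"
  assumes dims: "p \<ge> 1" "q \<ge> 1" "N \<ge> 1" "r \<le> q - 1"
    and M: "M = N * q - r"
    and meas: "matrix_measure q p \<Delta> \<nu> w"
    and minors: "\<And>n. det (mat n n (\<lambda>(i,j). moment_matrix q p \<Delta> \<nu> w i j)) \<noteq> 0"
    and GB: "gauss_borel (moment_matrix q p \<Delta> \<nu> w) S H Sb"
    and Lc: "\<And>l. l \<le> N \<Longrightarrow> Lc l \<in> carrier_mat q q"
    and Lblocks: "L1 \<in> carrier_mat r (q - r)" "L3 \<in> carrier_mat (q - r) (q - r)"
      "L4 \<in> carrier_mat (q - r) r"
    and LN: "Lc N = four_block_mat (0\<^sub>m r (q - r)) (0\<^sub>m r r) (1\<^sub>m (q - r)) (0\<^sub>m (q - r) r)"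
    and LN1: "Lc (N - 1) = four_block_mat L1 (1\<^sub>m r) L3 L4"
    and L: "L = poly_mat q N Lc"
    and GB': "gauss_borel (moment_matrix q p \<Delta> \<nu> (left_perturb q L w)) S' H' Sb'"
    and zeros: "bij_betw y {..<M} {z. poly (det L) z = 0}"
    and simple: "\<And>i. i < M \<Longrightarrow> order (y i) (det L) = 1"
    and v: "\<And>i. i < M \<Longrightarrow> v i \<in> carrier_vec q" "\<And>i. i < M \<Longrightarrow> v i \<noteq> 0\<^sub>v q"
      "\<And>i. i < M \<Longrightarrow> eval_mat L (y i) *\<^sub>v v i = 0\<^sub>v q"
    and fam: "A = Afam p Sb" "B = Bfam q S H"
    and fam': "A' = Afam p Sb'" "B' = Bfam q S' H'"
    and BB: "\<BB> = (\<lambda>n i. \<Sum>b<q. B (y i) n b * vec_index (v i) b)"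
    and KK: "\<KK> = (\<lambda>a n x i. \<Sum>b<q. CD_kernel A B n x (y i) a b * vec_index (v i) b)"
    and tau: "\<tau> = (\<lambda>n. det (mat M M (\<lambda>(j,i). \<BB> (n + j) i)))"
  shows "(\<forall>n. \<tau> n \<noteq> 0) \<and>
    (\<forall>n\<ge>1. \<forall>a<p. \<forall>x. A' x a (n - 1) =
       1 / \<tau> (n - 1) * det (mat M M (\<lambda>(j,i). if j = 0 then \<KK> a n x i else \<BB> (n + j - 1) i))) \<and>
    (\<forall>n. \<forall>b<q. \<forall>x. (\<Sum>c<q. B' x n c * eval_mat L x $$ (c,b)) =
       1 / \<tau> (n + 1) * det (mat (M + 1) (M + 1)
         (\<lambda>(j,i). if i = 0 then B x (n + j) b else \<BB> (n + j) (i - 1))))"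
proof -
  have q: "q > 0" using dims by simp
  have Lq: "L \<in> carrier_mat q q" by (simp add: L poly_mat_def)
  note banded = block_toeplitz_poly_mat_banded[OF dims(2-4) M Lblocks LN LN1, folded L]
  obtain \<Omega> where band: "upper_bandwidth M \<Omega>" and top: "\<And>n. \<Omega> n (n + M) \<noteq> 0"
    and unit: "lower_unitriangular (stranspose \<Omega>)"
    and \<Omega>B: "\<And>x. \<Omega> \<odot> B x = B' x \<odot> smat_of_mat q (eval_mat L x)"
    and A\<Omega>: "\<And>x. A' x \<odot> \<Omega> = A x"
    unfolding fam fam' by (rule gauss_borel_connection[OF meas Lq q banded GB GB']) blast
  have diag: "\<Omega> n n = 1" and below: "m < n \<Longrightarrow> \<Omega> n m = 0" for n m
    using unit by (auto simp: lower_unitriangular_def stranspose_def)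
  have B'L: "(\<Sum>c<q. B' x n c * eval_mat L x $$ (c, b)) = (\<Sum>k\<in>{n..n + M}. \<Omega> n k * B x k b)"
    if "b < q" for x n b
  proof -
    have "(\<Sum>c<q. B' x n c * eval_mat L x $$ (c, b)) = (\<Omega> \<odot> B x) n b"
      unfolding \<Omega>B using that by (subst smult_mat_eq_sum[where K = "{..<q}"]) (auto simp: smat_of_mat_def)
    also have "\<dots> = (\<Sum>k\<in>{n..n + M}. \<Omega> n k * B x k b)"
      by (rule smult_mat_eq_sum) (use band below in \<open>auto simp: upper_bandwidth_def not_le\<close>)
    finally show ?thesis .
  qed
  \<comment> \<open>Contracting \<open>B'L\<close> at \<open>y i\<close> with \<open>v i\<close>
    kills the left-hand side, since \<open>v i\<close> is in the kernel.\<close>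
  have rec: "(\<Sum>k\<in>{n..n + M}. \<Omega> n k * \<BB> k i) = 0" if i: "i < M" for n i
  proof -
    have ker: "(\<Sum>b<q. eval_mat L (y i) $$ (c, b) * v i $ b) = 0" if "c < q" for c
    proof -
      have "(eval_mat L (y i) *\<^sub>v v i) $ c = (\<Sum>b<q. eval_mat L (y i) $$ (c, b) * v i $ b)"
        using that v(1)[OF i] Lq by (simp add: eval_mat_def scalar_prod_def atLeast0LessThan)
      then show ?thesis using v(3)[OF i] that by simp
    qed
    have "(\<Sum>k\<in>{n..n + M}. \<Omega> n k * \<BB> k i)
        = (\<Sum>b<q. (\<Sum>k\<in>{n..n + M}. \<Omega> n k * B (y i) k b) * v i $ b)"
      unfolding BB sum_distrib_left sum_distrib_right
      by (subst sum.swap) (simp add: mult.assoc)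
    also have "\<dots> = (\<Sum>b<q. \<Sum>c<q. B' (y i) n c * (eval_mat L (y i) $$ (c, b) * v i $ b))"
      by (simp add: sum_distrib_right mult.assoc flip: B'L)
    also have "\<dots> = (\<Sum>c<q. B' (y i) n c * (\<Sum>b<q. eval_mat L (y i) $$ (c, b) * v i $ b))"
      by (subst sum.swap) (simp add: sum_distrib_left)
    also have "\<dots> = 0" by (simp add: ker)
    finally show ?thesis .
  qed
  have \<tau>: "\<tau> n \<noteq> 0" for n
    unfolding tau
  proof (rule window_det_nonzero[where F = \<BB> and \<Omega> = \<Omega>])
    fix c i assume zero: "\<And>m. (\<Sum>i<M. c i * \<BB> m i) = 0" and i: "i < M"
    show "c i = 0"
      using bij_betw_imp_inj_on[OF zeros] v(1,2) zero[unfolded BB fam] i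
      by (rule Bfam_eigenvalues_independent[OF GB q])
  qed (auto simp: rec diag top)
  have M0: "M > 0"
  proof -
    have "1 * q \<le> N * q" using dims by (intro mult_le_mono1)
    then show ?thesis using M dims by linarith
  qed
  have formA: "A' x a (n - 1) =
       1 / \<tau> (n - 1) * det (mat M M (\<lambda>(j,i). if j = 0 then \<KK> a n x i else \<BB> (n + j - 1) i))"
    if n: "n \<ge> 1" for n a x
  proof -
    \<comment> \<open>These are the entries of \<open>\<Omega>\<close> in rows
      \<open>l < n - 1\<close> that lie to the right of the leading block of size \<open>n\<close>,
      contracted with \<open>A'\<close>. The sign comes from trading the part of a recurrence inside
      the block for the part outside.\<close>
    define c where "c j = - (\<Sum>l<n - 1. A' x a l * \<Omega> l (n + j - 1))" for j
    have A: "A x a k = (\<Sum>l<n. A' x a l * \<Omega> l k)" if "k < n" for k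
      unfolding A\<Omega>[symmetric]
      by (rule smult_mat_eq_sum) (use that below in auto)
    have "\<KK> a n x i = A' x a (n - 1) * \<BB> (n - 1) i + (\<Sum>j\<in>{1..<M}. c j * \<BB> (n + j - 1) i)"
      if i: "i < M" for i
    proof -
      \<comment> \<open>Row \<open>l\<close> ends at \<open>l + M \<le> n + M - 2\<close>, so what
        the cut at \<open>n\<close> removes involves only the lower rows of the determinant.\<close>
      have tail: "(\<Sum>k<n. \<Omega> l k * \<BB> k i) = - (\<Sum>j\<in>{1..<M}. \<Omega> l (n + j - 1) * \<BB> (n + j - 1) i)"
        if l: "l < n - 1" for l
      proof -
        have "(\<Sum>k<n + M - 1. \<Omega> l k * \<BB> k i) = (\<Sum>k\<in>{l..l + M}. \<Omega> l k * \<BB> k i)"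
          using l band below by (intro sum.mono_neutral_right) (auto simp: upper_bandwidth_def not_le)
        then have "(\<Sum>k<n + M - 1. \<Omega> l k * \<BB> k i) = 0" by (simp add: rec i)
        moreover have union: "{..<n + M - 1} = {..<n} \<union> {n..<n + M - 1}" using M0 by auto
        have "(\<Sum>k<n + M - 1. \<Omega> l k * \<BB> k i)
            = (\<Sum>k<n. \<Omega> l k * \<BB> k i) + (\<Sum>k\<in>{n..<n + M - 1}. \<Omega> l k * \<BB> k i)"
          unfolding union by (rule sum.union_disjoint) auto
        moreover have "(\<Sum>k\<in>{n..<n + M - 1}. \<Omega> l k * \<BB> k i)
            = (\<Sum>j\<in>{1..<M}. \<Omega> l (n + j - 1) * \<BB> (n + j - 1) i)"
          by (rule sum.reindex_bij_witness[of _ "\<lambda>j. n + j - 1" "\<lambda>k. k + 1 - n"]) (use n in auto)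
        ultimately show ?thesis by (simp add: eq_neg_iff_add_eq_0)
      qed
      \<comment> \<open>In row \<open>n - 1\<close> the cut leaves just the unit diagonal entry, the
        source of the main term.\<close>
      have last: "(\<Sum>k<n. \<Omega> (n - 1) k * \<BB> k i) = \<BB> (n - 1) i"
      proof -
        have "\<Omega> (n - 1) k = 0" if "k \<in> {..<n} - {n - 1}" for k
          using that by (intro below) auto
        then show ?thesis
          using n diag[of "n - 1"] by (subst sum.remove[where x = "n - 1"]) auto
      qed
      have "\<KK> a n x i = (\<Sum>k<n. A x a k * \<BB> k i)"
        unfolding KK BB CD_kernel_def sum_distrib_left sum_distrib_right
        by (subst sum.swap) (simp add: mult.assoc)
      also have "\<dots> = (\<Sum>k<n. \<Sum>l<n. A' x a l * (\<Omega> l k * \<BB> k i))"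
        by (simp add: A sum_distrib_right mult.assoc)
      also have "\<dots> = (\<Sum>l<n. A' x a l * (\<Sum>k<n. \<Omega> l k * \<BB> k i))"
        by (subst sum.swap) (simp add: sum_distrib_left)
      also have "\<dots> = A' x a (n - 1) * \<BB> (n - 1) i + (\<Sum>l<n - 1. A' x a l * (\<Sum>k<n. \<Omega> l k * \<BB> k i))"
        using n last sum.lessThan_Suc[of "\<lambda>l. A' x a l * (\<Sum>k<n. \<Omega> l k * \<BB> k i)" "n - 1"] by simp
      also have "(\<Sum>l<n - 1. A' x a l * (\<Sum>k<n. \<Omega> l k * \<BB> k i))
          = (\<Sum>l<n - 1. \<Sum>j\<in>{1..<M}. - (A' x a l * \<Omega> l (n + j - 1) * \<BB> (n + j - 1) i))"
        by (intro sum.cong refl) (simp add: tail sum_distrib_left sum_negf mult.assoc)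
      also have "\<dots> = (\<Sum>j\<in>{1..<M}. c j * \<BB> (n + j - 1) i)"
        unfolding c_def by (subst sum.swap) (simp add: sum_distrib_right sum_negf)
      finally show ?thesis .
    qed
    note det_first_row_combination[OF M0 this]
    also have "mat M M (\<lambda>(j,i). if j = 0 then \<BB> (n - 1) i else \<BB> (n + j - 1) i)
        = mat M M (\<lambda>(j,i). \<BB> (n - 1 + j) i)"
      using n by (intro cong_mat) auto
    finally show ?thesis using \<tau>[of "n - 1"] by (simp add: tau)
  qed
  have formB: "(\<Sum>c<q. B' x n c * eval_mat L x $$ (c,b)) =
       1 / \<tau> (n + 1) * det (mat (M + 1) (M + 1)
         (\<lambda>(j,i). if i = 0 then B x (n + j) b else \<BB> (n + j) (i - 1)))"
    if b: "b < q" for n b x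
  proof -
    define W where "W j i = (if i = 0 then B x (n + j) b else \<BB> (n + j) (i - 1))" for j i
    define \<beta> where "\<beta> = (\<Sum>c<q. B' x n c * eval_mat L x $$ (c,b))"
    define u where "u i = (if i = 0 then \<beta> else 0)" for i :: nat
    have split: "(\<Sum>k\<in>{n..n + M}. \<Omega> n k * f k) = f n + (\<Sum>j\<in>{1..<Suc M}. \<Omega> n (n + j) * f (n + j))"
      for f :: "nat \<Rightarrow> complex"
    proof -
      have "(\<Sum>k\<in>{n..n + M}. \<Omega> n k * f k) = f n + (\<Sum>k\<in>{n..n + M} - {n}. \<Omega> n k * f k)"
        by (subst sum.remove[where x = n]) (auto simp: diag)
      also have "(\<Sum>k\<in>{n..n + M} - {n}. \<Omega> n k * f k)
          = (\<Sum>j\<in>{1..<Suc M}. \<Omega> n (n + j) * f (n + j))"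
        by (rule sum.reindex_bij_witness[of _ "\<lambda>j. n + j" "\<lambda>k. k - n"]) auto
      finally show ?thesis .
    qed
    \<comment> \<open>Row \<open>n\<close> of the connection relation solved for its leading term:
      column 0 uses \<open>B'L\<close> and leaves \<open>\<beta>\<close>, the other columns use
      \<open>rec\<close> and leave 0.\<close>
    have "W 0 i = 1 * u i + (\<Sum>j\<in>{1..<Suc M}. - \<Omega> n (n + j) * W j i)" if i: "i < Suc M" for i
    proof (cases "i = 0")
      case True
      then show ?thesis
        using B'L[OF b, of x n] split[of "\<lambda>k. B x k b"] by (simp add: W_def u_def \<beta>_def sum_negf)
    next
      case False
      then show ?thesis
        using rec[of "i - 1" n] split[of "\<lambda>k. \<BB> k (i - 1)"] i
        by (simp add: W_def u_def sum_negf eq_neg_iff_add_eq_0 del: sum.op_ivl_Suc)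
    qed
    from det_first_row_combination[OF zero_less_Suc this]
    have "det (mat (Suc M) (Suc M) (\<lambda>(j,i). if j = 0 then W 0 i else W j i))
        = det (mat (Suc M) (Suc M) (\<lambda>(j,i). if j = 0 then u i else W j i))" by simp
    moreover have "det (mat (Suc M) (Suc M) (\<lambda>(j,i). if j = 0 then u i else W j i)) = \<beta> * \<tau> (n + 1)"
    proof -
      obtain C where
        C: "\<And>u. det (mat (Suc M) (Suc M) (\<lambda>(j,i). if j = 0 then u i else W j i)) = (\<Sum>i<Suc M. u i * C i)"
        and C0: "C 0 = det (mat M M (\<lambda>(j,i). W (Suc j) (Suc i)))"
        by (rule det_first_row[of M W]) blast
      \<comment> \<open>Deleting row 0 and column 0 leaves the window that starts at
        \<open>n + 1\<close>, hence the index of \<open>\<tau>\<close>.\<close>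
      have "(\<Sum>i<Suc M. u i * C i) = \<beta> * C 0"
        by (subst sum.remove[where x = 0]) (auto simp: u_def intro!: sum.neutral)
      then show ?thesis unfolding C C0 by (simp add: W_def tau)
    qed
    moreover have "mat (Suc M) (Suc M) (\<lambda>(j,i). if j = 0 then W 0 i else W j i)
        = mat (M + 1) (M + 1) (\<lambda>(j,i). if i = 0 then B x (n + j) b else \<BB> (n + j) (i - 1))"
      by (intro cong_mat) (auto simp: W_def)
    ultimately show ?thesis using \<tau>[of "n + 1"] by (simp add: \<beta>_def)
  qed
  show ?thesis using \<tau> formA formB by blast
qed

end
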